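(* Let $q, \ell, t$ be positive integers. The number of $t$-tail-heavy words of length $\ell$ and depth $q$ is at most $t\, q^{t}\, c_q^{\ell + \sqrt{\ell} + 10}$.
   Context: A word $w_1 \cdots w_\ell \in \{1,\dots,q\}^\ell$ is $t$-tail-heavy of depth $q$ if there exist $n > \sqrt{\ell}$ indices $i_1, \dots, i_n$, all greater than $\ell - t$, such that $w_{i_1} = \cdots = w_{i_n} = q$, and such that for all (not necessarily distinct) $x, y \leq \ell - t$ with $x + y \in \{i_1, \dots, i_n\}$ we have $w_x + w_y \geq q$. For $q \geq 1$, $c_q := \sqrt{\lfloor (q+2)^2/4 \rfloor}$. *)

theory Defs
  imports Complex_Main
begin

text \<open>Words of length l over the alphabet {1..q} are lists; the letter w_i (1-based)
  is w ! (i - 1).\<close>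

definition words :: "nat \<Rightarrow> nat \<Rightarrow> nat list set" where
  "words q l = {w. length w = l \<and> set w \<subseteq> {1..q}}"

definition tail_heavy :: "nat \<Rightarrow> nat \<Rightarrow> nat list \<Rightarrow> bool" where
  "tail_heavy t q w \<longleftrightarrow>
     (let l = length w in
      \<exists>I :: nat set. I \<subseteq> {l - t <.. l} \<and> real (card I) > sqrt (real l) \<and>
        (\<forall>i\<in>I. w ! (i - 1) = q) \<and>
        (\<forall>x y. 1 \<le> x \<and> x \<le> l - t \<and> 1 \<le> y \<and> y \<le> l - t \<and> x + y \<in> I \<longrightarrow>
               w ! (x - 1) + w ! (y - 1) \<ge> q))"

definition c_const :: "nat \<Rightarrow> real" where
  "c_const q = sqrt (real ((q + 2)^2 div 4))"

end

theory Submission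
  imports Defs "HOL-Library.FuncSet"
begin

text \<open>
  Put \<open>m = l - t\<close> and fix the set \<open>I\<close> of heavy positions, of size \<open>n > \<surd>l\<close>. The admissible
  prefixes of length \<open>m\<close> are counted by Kahn's entropy method, revealing the letters of a uniformly
  random prefix from position \<open>m\<close> down to \<open>1\<close>. Let \<open>h v\<close> be the entropy of the letter at \<open>v\<close> given
  the later ones, let \<open>P v\<close> be the set of \<open>y > v\<close> with \<open>v + y \<in> I\<close>, and let \<open>a\<close> be the smallest
  letter on \<open>P v\<close>. Given \<open>a\<close>, the letter at \<open>v\<close> has at most \<open>a + 1\<close> values and each letter on \<open>P v\<close> at
  most \<open>q - a + 1\<close>, and \<open>(a + 1) (q - a + 1) \<le> c\<^sup>2\<close>. Hence
  \<open>|P v| h v + (\<Sum>y\<in>P v. h y) \<le> ln q + 2 |P v| ln c\<close>. Summing over \<open>v\<close> counts every \<open>h v\<close> with weight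
  \<open>n\<close>, up to a boundary defect of at most \<open>n t\<close> in total, so that there are at most
  \<open>q^t c^(m - t + \<surd>l)\<close> prefixes. A given \<open>I\<close> leaves \<open>q^(t - |I|)\<close> tails, and these
  numbers add up to \<open>(q + 1)^t \<le> c^(2 t)\<close>.
\<close>

section \<open>Conditional entropy of the uniform distribution: Gibbs' inequality, monotonicity,
  chain rule\<close>

text \<open>
  This is \<open>|S|\<close> times the conditional entropy of \<open>f\<close> given \<open>g\<close> under the uniform distribution on \<open>S\<close>.
  Conditioning on a constant gives the plain entropy.
\<close>
definition cond_entropy :: "'a set \<Rightarrow> ('a \<Rightarrow> 'b) \<Rightarrow> ('a \<Rightarrow> 'c) \<Rightarrow> real" where
  "cond_entropy S f g = (\<Sum>s\<in>S. ln (real (card {r \<in> S. g r = g s}) /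
                               real (card {r \<in> S. f r = f s \<and> g r = g s})))"

text \<open>Each value is attained on its whole fibre, so the weights \<open>1 / card\<close> of
  that fibre add up to 1. This is how sums over samples become sums over values in Gibbs'
  inequality.\<close>

lemma sum_div_card_fibre:
  fixes X :: "'b \<Rightarrow> real"
  assumes "finite F"
  shows "(\<Sum>s\<in>F. X (f s) / real (card {r \<in> F. f r = f s})) = (\<Sum>a\<in>f ` F. X a)"
proof -
  have "(\<Sum>s\<in>F. X (f s) / real (card {r \<in> F. f r = f s}))
      = (\<Sum>a\<in>f ` F. \<Sum>s\<in>{s\<in>F. f s = a}. X (f s) / real (card {r \<in> F. f r = f s}))"
    by (rule sum.image_gen[OF assms])
  also have "\<dots> = (\<Sum>a\<in>f ` F. X a)"
  proof (rule sum.cong[OF refl])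
    fix a assume a: "a \<in> f ` F"
    have "card {s\<in>F. f s = a} > 0" using a assms by (auto simp: card_gt_0_iff)
    then show "(\<Sum>s\<in>{s\<in>F. f s = a}. X (f s) / real (card {r \<in> F. f r = f s})) = X a" by simp
  qed
  finally show ?thesis .
qed

text \<open>\<open>Q\<close> is a competing sub-probability kernel, compared with the true
  conditional frequencies \<open>M s / N s\<close> via \<open>ln x \<le> x - 1\<close>. The
  resulting sum of \<open>N s * Q / M s\<close> is at most \<open>card S\<close>. Upper bounds on
  entropy below come from suitable choices of \<open>Q\<close>.\<close>

lemma cond_entropy_gibbs:
  assumes S: "finite S"
    and pos: "\<And>s. s \<in> S \<Longrightarrow> Q (g s) (f s) > 0"
    and le1: "\<And>s. s \<in> S \<Longrightarrow> (\<Sum>a\<in>f ` {r \<in> S. g r = g s}. Q (g s) a) \<le> (1::real)"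
  shows "cond_entropy S f g \<le> (\<Sum>s\<in>S. - ln (Q (g s) (f s)))"
proof -
  define N where "N s = real (card {r \<in> S. g r = g s})" for s
  define M where "M s = real (card {r \<in> S. f r = f s \<and> g r = g s})" for s
  have NM: "N s > 0" "M s > 0" if "s \<in> S" for s
    using that S by (auto simp: N_def M_def card_gt_0_iff)
  have "cond_entropy S f g - (\<Sum>s\<in>S. - ln (Q (g s) (f s))) = (\<Sum>s\<in>S. ln (N s * Q (g s) (f s) / M s))"
    unfolding cond_entropy_def sum_subtractf[symmetric]
  proof (rule sum.cong[OF refl])
    fix s assume s: "s \<in> S"
    show "ln (real (card {r \<in> S. g r = g s}) / real (card {r \<in> S. f r = f s \<and> g r = g s})) -
         - ln (Q (g s) (f s)) = ln (N s * Q (g s) (f s) / M s)"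
      using NM[OF s] pos[OF s] unfolding N_def[symmetric] M_def[symmetric]
      by (simp add: ln_mult ln_div)
  qed
  also have "\<dots> \<le> (\<Sum>s\<in>S. N s * Q (g s) (f s) / M s - 1)"
    using NM pos by (intro sum_mono ln_le_minus_one) simp
  also have "\<dots> = (\<Sum>s\<in>S. N s * Q (g s) (f s) / M s) - card S" by (simp add: sum_subtractf)
  also have "(\<Sum>s\<in>S. N s * Q (g s) (f s) / M s)
      = (\<Sum>b\<in>g ` S. \<Sum>s\<in>{s\<in>S. g s = b}. N s * Q (g s) (f s) / M s)"
    by (rule sum.image_gen[OF S])
  also have "\<dots> \<le> (\<Sum>b\<in>g ` S. real (card {s\<in>S. g s = b}))"
  proof (rule sum_mono)
    fix b assume "b \<in> g ` S"
    then obtain s0 where s0: "s0 \<in> S" "b = g s0" by auto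
    let ?F = "{s\<in>S. g s = b}"
    have "(\<Sum>s\<in>?F. N s * Q (g s) (f s) / M s)
        = (\<Sum>s\<in>?F. real (card ?F) * Q b (f s) / real (card {r\<in>?F. f r = f s}))"
    proof (rule sum.cong[OF refl])
      fix s assume s: "s \<in> ?F"
      have "{r \<in> S. f r = f s \<and> g r = g s} = {r\<in>?F. f r = f s}" using s by auto
      then show "N s * Q (g s) (f s) / M s
        = real (card ?F) * Q b (f s) / real (card {r\<in>?F. f r = f s})"
        using s by (simp add: N_def M_def)
    qed
    also have "\<dots> = (\<Sum>a\<in>f ` ?F. real (card ?F) * Q b a)"
      by (rule sum_div_card_fibre[where X="\<lambda>a. real (card ?F) * Q b a"]) (use S in auto)
    also have "\<dots> = real (card ?F) * (\<Sum>a\<in>f ` ?F. Q b a)" by (simp add: sum_distrib_left)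
    also have "\<dots> \<le> real (card ?F) * 1"
      using le1[OF s0(1)] s0(2) by (intro mult_left_mono) auto
    finally show "(\<Sum>s\<in>?F. N s * Q (g s) (f s) / M s) \<le> real (card ?F)" by simp
  qed
  also have "(\<Sum>b\<in>g ` S. real (card {s\<in>S. g s = b})) = real (card S)"
    using sum.image_gen[OF S, of "\<lambda>_. 1::real" g] by simp
  finally show ?thesis by simp
qed

text \<open>Gibbs' inequality with \<open>Q\<close> uniform on the set \<open>K (g s)\<close> of
  values still possible once \<open>g s\<close> is known.\<close>

lemma cond_entropy_le_ln_card:
  assumes S: "finite S"
    and K: "\<And>s. s \<in> S \<Longrightarrow> finite (K (g s)) \<and> f s \<in> K (g s)"
  shows "cond_entropy S f g \<le> (\<Sum>s\<in>S. ln (real (card (K (g s)))))"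
proof -
  have pos: "card (K (g s)) > 0" if "s \<in> S" for s
    using K[OF that] by (auto simp: card_gt_0_iff)
  have "cond_entropy S f g \<le> (\<Sum>s\<in>S. - ln ((\<lambda>b a. 1 / real (card (K b))) (g s) (f s)))"
  proof (rule cond_entropy_gibbs[OF S])
    fix s assume s: "s \<in> S"
    show "1 / real (card (K (g s))) > 0" using pos[OF s] by simp
    have "f ` {r \<in> S. g r = g s} \<subseteq> K (g s)" using K by force
    then have "card (f ` {r \<in> S. g r = g s}) \<le> card (K (g s))" using K[OF s] card_mono by blast
    then show "(\<Sum>a\<in>f ` {r \<in> S. g r = g s}. 1 / real (card (K (g s)))) \<le> 1"
      using pos[OF s] by (simp add: divide_le_eq)
  qed
  also have "\<dots> = (\<Sum>s\<in>S. ln (real (card (K (g s)))))"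
    using pos by (intro sum.cong) (auto simp: ln_div)
  finally show ?thesis .
qed

text \<open>Gibbs' inequality with \<open>Q\<close> the distribution of \<open>f\<close> given the
  coarser \<open>g\<close>, which on \<open>S\<close> is a function of \<open>g'\<close>; the cross
  entropy is then exactly the entropy given \<open>g\<close>.\<close>

lemma cond_entropy_antimono:
  assumes S: "finite S"
    and ker: "\<And>r s. r \<in> S \<Longrightarrow> s \<in> S \<Longrightarrow> g' r = g' s \<Longrightarrow> g r = g s"
  shows "cond_entropy S f g' \<le> cond_entropy S f g"
proof -
  \<comment> \<open>The map through which \<open>g\<close> factors on \<open>S\<close>, read off
    from a representative of each fibre of \<open>g'\<close>.\<close>
  define \<phi> where "\<phi> b = g (SOME r. r \<in> S \<and> g' r = b)" for b
  have \<phi>: "\<phi> (g' s) = g s" if "s \<in> S" for s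
  proof -
    have "(SOME r. r \<in> S \<and> g' r = g' s) \<in> S \<and> g' (SOME r. r \<in> S \<and> g' r = g' s) = g' s"
      by (rule someI[of "\<lambda>r. r \<in> S \<and> g' r = g' s" s]) (use that in simp)
    then show ?thesis unfolding \<phi>_def using ker that by blast
  qed
  define Q where "Q b a = real (card {r \<in> S. f r = a \<and> g r = \<phi> b}) / real (card {r \<in> S. g r = \<phi> b})" for b a
  have "cond_entropy S f g' \<le> (\<Sum>s\<in>S. - ln (Q (g' s) (f s)))"
  proof (rule cond_entropy_gibbs[OF S])
    fix s assume s: "s \<in> S"
    have ne: "card {r \<in> S. g r = g s} > 0" using s S by (auto simp: card_gt_0_iff)
    show "Q (g' s) (f s) > 0"
      unfolding Q_def \<phi>[OF s] using s S by (auto simp: card_gt_0_iff intro!: divide_pos_pos)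
    let ?G = "{r \<in> S. g r = g s}"
    have "(\<Sum>a\<in>f ` {r \<in> S. g' r = g' s}. Q (g' s) a)
        \<le> (\<Sum>a\<in>f ` ?G. Q (g' s) a)"
    proof (rule sum_mono2)
      show "f ` {r \<in> S. g' r = g' s} \<subseteq> f ` ?G"
        by (rule image_mono) (use ker s in blast)
    qed (use S in \<open>simp_all add: Q_def\<close>)
    also have "\<dots> = (\<Sum>a\<in>f ` ?G. \<Sum>r\<in>{r\<in>?G. f r = a}. 1) / real (card ?G)"
      unfolding Q_def \<phi>[OF s] sum_divide_distrib by (intro sum.cong) (auto intro!: arg_cong[where f=card])
    also have "(\<Sum>a\<in>f ` ?G. \<Sum>r\<in>{r\<in>?G. f r = a}. 1::real) = real (card ?G)"
      using sum.image_gen[of ?G "\<lambda>_. 1::real" f] S by simp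
    finally show "(\<Sum>a\<in>f ` {r \<in> S. g' r = g' s}. Q (g' s) a) \<le> 1" using ne by simp
  qed
  also have "\<dots> = cond_entropy S f g"
    unfolding cond_entropy_def
  proof (rule sum.cong[OF refl])
    fix s assume s: "s \<in> S"
    have "card {r \<in> S. g r = g s} > 0" "card {r \<in> S. f r = f s \<and> g r = g s} > 0"
      using s S by (auto simp: card_gt_0_iff)
    then show "- ln (Q (g' s) (f s)) = ln (real (card {r \<in> S. g r = g s}) / real (card {r \<in> S. f r = f s \<and> g r = g s}))"
      unfolding Q_def \<phi>[OF s] by (simp add: ln_div)
  qed
  finally show ?thesis .
qed

text \<open>\<open>e\<close> carries the same information as the pair of \<open>f\<close> and
  \<open>h\<close>, and the identity holds sample by sample: the fibre size of \<open>h\<close>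
  cancels between the two quotients.\<close>

lemma cond_entropy_chain:
  assumes S: "finite S"
    and ker: "\<And>r s. r \<in> S \<Longrightarrow> s \<in> S \<Longrightarrow> e r = e s \<longleftrightarrow> f r = f s \<and> h r = h s"
  shows "cond_entropy S e (\<lambda>_. ()) = cond_entropy S h (\<lambda>_. ()) + cond_entropy S f h"
  unfolding cond_entropy_def sum.distrib[symmetric]
proof (rule sum.cong[OF refl])
  fix s assume s: "s \<in> S"
  have *: "{r \<in> S. e r = e s \<and> () = ()} = {r \<in> S. f r = f s \<and> h r = h s}" using ker s by auto
  have "card {r \<in> S. h r = h s} > 0" "card {r \<in> S. f r = f s \<and> h r = h s} > 0" "card S > 0"
    using s S by (auto simp: card_gt_0_iff)
  then show "ln (real (card {r \<in> S. () = ()}) / real (card {r \<in> S. e r = e s \<and> () = ()})) =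
         ln (real (card {r \<in> S. () = ()}) / real (card {r \<in> S. h r = h s \<and> () = ()})) +
         ln (real (card {r \<in> S. h r = h s}) / real (card {r \<in> S. f r = f s \<and> h r = h s}))"
    unfolding * by (simp add: ln_div)
qed

text \<open>\<open>W s x\<close> is letter \<open>x\<close> of the sample \<open>s\<close>. Being
  \<open>undefined\<close> off \<open>A\<close> makes equality of projections mean agreement on
  \<open>A\<close>, so that a set of letters can serve as a conditioning variable.\<close>

definition proj :: "('a \<Rightarrow> nat \<Rightarrow> 'b) \<Rightarrow> nat set \<Rightarrow> 'a \<Rightarrow> nat \<Rightarrow> 'b" where
  "proj W A s = restrict (W s) A"

lemma proj_eq_iff: "proj W A r = proj W A s \<longleftrightarrow> (\<forall>x\<in>A. W r x = W s x)"
  unfolding proj_def restrict_def fun_eq_iff by auto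

text \<open>Letters are revealed from the largest position down. The induction adds a new minimum,
  which enters no conditioning set of the other positions.\<close>

lemma cond_entropy_proj_chain:
  assumes S: "finite S" and "finite A"
  shows "cond_entropy S (proj W A) (\<lambda>_. ()) = (\<Sum>b\<in>A. cond_entropy S (\<lambda>s. W s b) (proj W (A \<inter> {b<..})))"
  using assms(2)
proof (induction A rule: finite_linorder_min_induct)
  case empty
  show ?case by (simp add: cond_entropy_def proj_def)
next
  case (insert b A)
  have b: "b \<notin> A" using insert by auto
  have "cond_entropy S (proj W (insert b A)) (\<lambda>_. ()) =
     cond_entropy S (proj W A) (\<lambda>_. ()) + cond_entropy S (\<lambda>s. W s b) (proj W A)"
    by (rule cond_entropy_chain[OF S]) (auto simp: proj_eq_iff)
  moreover have "insert b A \<inter> {b<..} = A" using insert by auto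
  moreover have "(\<Sum>x\<in>A. cond_entropy S (\<lambda>s. W s x) (proj W (insert b A \<inter> {x<..}))) =
     (\<Sum>x\<in>A. cond_entropy S (\<lambda>s. W s x) (proj W (A \<inter> {x<..})))"
  proof (rule sum.cong[OF refl])
    fix x assume "x \<in> A"
    then have "insert b A \<inter> {x<..} = A \<inter> {x<..}" using insert by force
    then show "cond_entropy S (\<lambda>s. W s x) (proj W (insert b A \<inter> {x<..})) = cond_entropy S (\<lambda>s. W s x) (proj W (A \<inter> {x<..}))" by simp
  qed
  ultimately show ?case using insert b by simp
qed

section \<open>Estimates for the constant \<open>c_const q\<close>\<close>

lemma c_const_sq: "c_const q ^ 2 = real ((q + 2)^2 div 4)"
  unfolding c_const_def by simp

lemma c_const_sq_ge: "real (q + 1) \<le> c_const q ^ 2"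
proof -
  have "4 * (q + 1) \<le> (q + 2)^2" by (simp add: power2_eq_square algebra_simps)
  then have "q + 1 \<le> (q + 2)^2 div 4" by (simp add: less_eq_div_iff_mult_less_eq)
  then show ?thesis unfolding c_const_sq by simp
qed

text \<open>The inequality of arithmetic and geometric means for two factors with sum
  \<open>q + 2\<close>; their product is an integer, so it survives the rounding in
  \<open>div 4\<close>.\<close>

lemma mult_le_c_const_sq:
  assumes "a \<le> q"
  shows "real (a + 1) * real (q - a + 1) \<le> c_const q ^ 2"
proof -
  obtain b where q: "q = a + b" using assms le_Suc_ex by blast
  have "4 * int ((a + 1) * (b + 1)) \<le> int ((a + b + 2)^2)"
    using zero_le_power2[of "int a - int b"] by (simp add: power2_eq_square algebra_simps)
  then have "4 * ((a + 1) * (b + 1)) \<le> (q + 2)^2" unfolding q by linarith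
  then have "(a + 1) * (b + 1) \<le> (q + 2)^2 div 4" by (simp add: less_eq_div_iff_mult_less_eq)
  then have "real ((a + 1) * (b + 1)) \<le> c_const q ^ 2" unfolding c_const_sq of_nat_le_iff .
  then show ?thesis unfolding of_nat_mult q by simp
qed

lemma c_const_ge_1: "c_const q \<ge> 1"
proof (rule power2_le_imp_le)
  show "1\<^sup>2 \<le> (c_const q)\<^sup>2" using c_const_sq_ge[of q] by simp
qed (simp add: c_const_def)

text \<open>This fails for \<open>q = 1\<close>, where the constant is \<open>sqrt 2\<close>; hence
  the separate treatment of that alphabet at the end.\<close>

lemma c_const_le:
  assumes "q \<ge> 2"
  shows "c_const q \<le> real q"
proof (rule power2_le_imp_le)
  have "(q + 2)^2 \<le> 4 * q^2"
    using power_mono[of "q+2" "2*q" 2] assms by (simp add: power_mult_distrib)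
  then have "(q + 2)^2 div 4 \<le> q^2" by linarith
  then show "(c_const q)\<^sup>2 \<le> (real q)\<^sup>2" unfolding c_const_sq
    by (metis of_nat_le_iff of_nat_power)
qed simp

lemma c_const_ge_half: "real (q div 2 + 1) \<le> c_const q"
proof (rule power2_le_imp_le)
  have "real (q div 2 + 1) ^ 2 \<le> real (q div 2 + 1) * real (q - q div 2 + 1)"
    unfolding power2_eq_square by (intro mult_left_mono) auto
  also have "\<dots> \<le> c_const q ^ 2" by (rule mult_le_c_const_sq) simp
  finally show "(real (q div 2 + 1))\<^sup>2 \<le> (c_const q)\<^sup>2" .
qed (use c_const_ge_1[of q] in simp)

section \<open>Kahn's entropy argument for words with sum constraints\<close>

text \<open>The weight \<open>card P\<close> matches each letter on \<open>P\<close> with one copy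
  of the letter at \<open>v\<close>, so the product bound applies to each match. The term
  \<open>ln q\<close> pays for the minimum \<open>a\<close> once, whatever the size of
  \<open>P\<close>.\<close>

lemma cond_entropy_vertex_le:
  fixes W :: "'a \<Rightarrow> nat \<Rightarrow> nat"
  assumes S: "finite S" and P: "finite P" "P \<noteq> {}" "P \<subseteq> B"
    and W: "\<And>s x. s \<in> S \<Longrightarrow> x \<in> insert v P \<Longrightarrow> W s x \<in> {1..q}"
    and con: "\<And>s y. s \<in> S \<Longrightarrow> y \<in> P \<Longrightarrow> q \<le> W s v + W s y"
  shows "real (card P) * cond_entropy S (\<lambda>s. W s v) (proj W B) + cond_entropy S (proj W P) (\<lambda>_. ())
     \<le> real (card S) * (ln (real q) + real (card P) * (2 * ln (c_const q)))"
proof -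
  define a where "a s = Min (W s ` P)" for s
  have a_in: "\<exists>y\<in>P. a s = W s y" for s
  proof -
    have "a s \<in> W s ` P" unfolding a_def using P by (intro Min_in) auto
    then show ?thesis by auto
  qed
  have a_le: "a s \<le> W s y" if "y \<in> P" for s y
    using that P unfolding a_def by auto
  have a_ker: "a r = a s" if "\<forall>y\<in>P. W r y = W s y" for r s
    unfolding a_def using that by (intro arg_cong[where f=Min] image_cong) auto
  have a_q: "a s \<in> {1..q}" if "s \<in> S" for s using a_in[of s] W[OF that] by auto
  have 1: "cond_entropy S (\<lambda>s. W s v) (proj W B) \<le> (\<Sum>s\<in>S. ln (real (a s + 1)))"
  proof -
    have "cond_entropy S (\<lambda>s. W s v) (proj W B) \<le> cond_entropy S (\<lambda>s. W s v) a"
    proof (rule cond_entropy_antimono[OF S])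
      fix r s assume "proj W B r = proj W B s"
      then show "a r = a s" using P(3) by (intro a_ker) (auto simp: proj_eq_iff)
    qed
    also have "\<dots> \<le> (\<Sum>s\<in>S. ln (real (card ((\<lambda>k. {q - k..q}) (a s)))))"
    proof (rule cond_entropy_le_ln_card[OF S])
      fix s assume s: "s \<in> S"
      \<comment> \<open>A position attaining the minimum gives the strongest constraint, leaving the
        \<open>a s + 1\<close> letters from \<open>q - a s\<close> to \<open>q\<close> for
        \<open>v\<close>.\<close>
      obtain y where y: "y \<in> P" "a s = W s y" using a_in by blast
      show "finite {q - a s..q} \<and> W s v \<in> {q - a s..q}"
        using con[OF s y(1)] y(2) W[OF s, of v] by auto
    qed
    also have "\<dots> = (\<Sum>s\<in>S. ln (real (a s + 1)))"
    proof (rule sum.cong[OF refl])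
      fix s assume "s \<in> S"
      then have "a s \<le> q" using a_q by force
      then have "card {q - a s..q} = a s + 1" by simp
      then show "ln (real (card {q - a s..q})) = ln (real (a s + 1))" by simp
    qed
    finally show ?thesis .
  qed
  \<comment> \<open>\<open>a\<close> is a function of the letters on \<open>P\<close>, so adjoining
    it to them adds no entropy.\<close>
  have 2: "cond_entropy S (proj W P) (\<lambda>_. ()) = cond_entropy S a (\<lambda>_. ()) + cond_entropy S (proj W P) a"
    by (rule cond_entropy_chain[OF S]) (auto simp: proj_eq_iff intro: a_ker)
  have 3: "cond_entropy S a (\<lambda>_. ()) \<le> real (card S) * ln (real q)"
    using cond_entropy_le_ln_card[OF S, of "\<lambda>_. {1..q}" "\<lambda>_. ()" a] a_q by simp
  have 4: "cond_entropy S (proj W P) a \<le> (\<Sum>s\<in>S. real (card P) * ln (real (q - a s + 1)))"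
  proof -
    have "cond_entropy S (proj W P) a \<le> (\<Sum>s\<in>S. ln (real (card ((\<lambda>k. PiE P (\<lambda>_. {k..q})) (a s)))))"
    proof (rule cond_entropy_le_ln_card[OF S])
      fix s assume s: "s \<in> S"
      show "finite (PiE P (\<lambda>_. {a s..q})) \<and> proj W P s \<in> PiE P (\<lambda>_. {a s..q})"
        using a_le W[OF s] P(1) by (auto simp: proj_def intro!: finite_PiE)
    qed
    also have "\<dots> = (\<Sum>s\<in>S. real (card P) * ln (real (q - a s + 1)))"
    proof (rule sum.cong[OF refl])
      fix s assume "s \<in> S"
      then have "a s \<le> q" using a_q by force
      then have "card (PiE P (\<lambda>_. {a s..q})) = (q - a s + 1) ^ card P"
        using P(1) by (simp add: card_PiE Suc_diff_le)
      then show "ln (real (card (PiE P (\<lambda>_. {a s..q})))) = real (card P) * ln (real (q - a s + 1))"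
        by (simp only: of_nat_power) (simp add: ln_realpow)
    qed
    finally show ?thesis .
  qed
  have 5: "(\<Sum>s\<in>S. ln (real (a s + 1)) + ln (real (q - a s + 1))) \<le> (\<Sum>s\<in>S. 2 * ln (c_const q))"
  proof (rule sum_mono)
    fix s assume "s \<in> S"
    then have "a s \<le> q" using a_q by force
    then have "ln (real (a s + 1) * real (q - a s + 1)) \<le> ln (c_const q ^ 2)"
      using mult_le_c_const_sq c_const_ge_1[of q] by (intro ln_mono) auto
    then show "ln (real (a s + 1)) + ln (real (q - a s + 1)) \<le> 2 * ln (c_const q)"
      using c_const_ge_1[of q] by (simp add: ln_mult ln_realpow)
  qed
  have "real (card P) * cond_entropy S (\<lambda>s. W s v) (proj W B) + cond_entropy S (proj W P) (\<lambda>_. ())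
     \<le> real (card P) * (\<Sum>s\<in>S. ln (real (a s + 1))) + (real (card S) * ln (real q)
        + (\<Sum>s\<in>S. real (card P) * ln (real (q - a s + 1))))"
    unfolding 2 using 1 3 4 by (intro add_mono mult_left_mono) auto
  also have "\<dots> = real (card S) * ln (real q) +
      real (card P) * (\<Sum>s\<in>S. ln (real (a s + 1)) + ln (real (q - a s + 1)))"
    by (simp add: sum.distrib sum_distrib_left algebra_simps)
  also have "\<dots> \<le> real (card S) * ln (real q) + real (card P) * (\<Sum>s\<in>S. 2 * ln (c_const q))"
    using 5 by (intro add_left_mono mult_left_mono) auto
  also have "\<dots> = real (card S) * (ln (real q) + real (card P) * (2 * ln (c_const q)))"
    by (simp add: algebra_simps)
  finally show ?thesis .
qed

text \<open>\<open>n\<close> times the total entropy is distributed over all pairs of a position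
  \<open>v\<close> and an \<open>i \<in> I\<close>, according to where the partner
  \<open>i - v\<close> lies. The last summand collects the one-off terms \<open>ln q\<close> of the
  vertex inequality.\<close>

lemma ln_card_sum_constrained_le:
  fixes W :: "'a \<Rightarrow> nat \<Rightarrow> nat"
  assumes S: "finite S" "S \<noteq> {}"
    and inj: "\<And>r s. r \<in> S \<Longrightarrow> s \<in> S \<Longrightarrow> (\<forall>x\<in>{1..m}. W r x = W s x) \<Longrightarrow> r = s"
    and W: "\<And>s x. s \<in> S \<Longrightarrow> x \<in> {1..m} \<Longrightarrow> W s x \<in> {1..q}"
    and I: "I \<subseteq> {m<..m+t}"
    and con: "\<And>s x y. s \<in> S \<Longrightarrow> x \<in> {1..m} \<Longrightarrow> y \<in> {1..m} \<Longrightarrow> x + y \<in> I \<Longrightarrow> q \<le> W s x + W s y"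
    and q: "q \<ge> 2"
  shows "real (card I) * ln (real (card S)) \<le>
    real (card I) * (real t * ln (real q) + (real m - real t) * ln (c_const q))
      + (real m + real t) / 2 * ln (real q)"
proof -
  define V where "V = {1..m}"
  define h where "h v = cond_entropy S (\<lambda>s. W s v) (proj W {v<..m})" for v
  define P where "P v = {y\<in>V. v < y \<and> v + y \<in> I}" for v
  define s where "s v = {y\<in>V. y < v \<and> v + y \<in> I}" for v
  define lp where "lp v = {y\<in>V. y = v \<and> v + y \<in> I}" for v
  define d where "d v = {i\<in>I. m + v < i}" for v
  define n where "n = real (card I)"
  define N where "N = real (card S)"
  define lc where "lc = ln (c_const q)"
  define lq where "lq = ln (real q)"
  \<comment> \<open>The positions at which the vertex inequality costs its extra
    \<open>ln q\<close>.\<close>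
  define R where "R = {v\<in>V. P v \<noteq> {}}"
  have finV: "finite V" by (simp add: V_def)
  have finI: "finite I" using I finite_subset by blast
  have fins: "finite (P v)" "finite (s v)" "finite (lp v)" "finite (d v)" for v
    using finV finI by (auto simp: P_def s_def lp_def d_def)
  have N0: "N > 0" using S by (simp add: N_def card_gt_0_iff)
  have lc0: "lc \<ge> 0" using c_const_ge_1[of q] by (simp add: lc_def)
  have lq0: "lq \<ge> 0" using q by (simp add: lq_def)
  have lclq: "lc \<le> lq"
    unfolding lc_def lq_def using c_const_le[OF q] c_const_ge_1[of q] by (intro ln_mono) auto

  \<comment> \<open>The letters determine the sample, so fibres are singletons and the joint entropy
    of a uniform sample is \<open>ln N\<close>, here scaled by \<open>N\<close>.\<close>
  have total: "N * ln N = (\<Sum>v\<in>V. h v)"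
  proof -
    have "cond_entropy S (proj W V) (\<lambda>_. ()) = (\<Sum>x\<in>S. ln N)"
      unfolding cond_entropy_def
    proof (rule sum.cong[OF refl])
      fix x assume x: "x \<in> S"
      have "{r \<in> S. proj W V r = proj W V x \<and> () = ()} = {x}"
        using inj x by (auto simp: proj_eq_iff V_def)
      then show "ln (real (card {r \<in> S. () = ()}) /
          real (card {r \<in> S. proj W V r = proj W V x \<and> () = ()})) = ln N"
        by (simp add: N_def)
    qed
    then have "N * ln N = cond_entropy S (proj W V) (\<lambda>_. ())" by (simp add: N_def)
    also have "\<dots> = (\<Sum>b\<in>V. cond_entropy S (\<lambda>s. W s b) (proj W (V \<inter> {b<..})))"
      by (rule cond_entropy_proj_chain[OF S(1) finV])
    also have "\<dots> = (\<Sum>v\<in>V. h v)"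
    proof (rule sum.cong[OF refl])
      fix b assume "b \<in> V"
      then have "V \<inter> {b<..} = {b<..m}" by (auto simp: V_def)
      then show "cond_entropy S (\<lambda>s. W s b) (proj W (V \<inter> {b<..})) = h b" by (simp add: h_def)
    qed
    finally show ?thesis .
  qed

  have h_lq: "h v \<le> N * lq" if "v \<in> V" for v
    unfolding h_def using cond_entropy_le_ln_card[OF S(1), of "\<lambda>_. {1..q}" "proj W {v<..m}" "\<lambda>s. W s v"] W that
    by (simp add: N_def lq_def V_def)
  \<comment> \<open>Paired with itself, the letter at \<open>v\<close> is at least half of
    \<open>q\<close>, which leaves \<open>q div 2 + 1\<close> values.\<close>
  have h_lc: "h v \<le> N * lc" if v: "v \<in> V" "v + v \<in> I" for v
  proof -
    have "h v \<le> (\<Sum>s\<in>S. ln (real (card {q - q div 2..q})))"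
      unfolding h_def
    proof (rule cond_entropy_le_ln_card[OF S(1)])
      fix s assume s: "s \<in> S"
      show "finite {q - q div 2..q} \<and> W s v \<in> {q - q div 2..q}"
        using con[OF s, of v v] W[OF s, of v] v by (auto simp: V_def)
    qed
    also have "\<dots> = N * ln (real (q div 2 + 1))" by (simp add: N_def)
    also have "\<dots> \<le> N * lc"
      unfolding lc_def using N0 c_const_ge_half[of q] by (intro mult_left_mono ln_mono) auto
    finally show ?thesis .
  qed
  have h_P: "real (card (P v)) * h v + (\<Sum>y\<in>P v. h y)
      \<le> N * (real (card (P v)) * (2 * lc)) + (if v \<in> R then N * lq else 0)" if v: "v \<in> V" for v
  proof (cases "P v = {}")
    case True
    then show ?thesis by (simp add: R_def)
  next
    case False
    \<comment> \<open>\<open>h y\<close> conditions on all later letters, the chain rule within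
      \<open>P v\<close> only on those in \<open>P v\<close>.\<close>
    have "(\<Sum>y\<in>P v. h y) \<le> (\<Sum>y\<in>P v. cond_entropy S (\<lambda>s. W s y) (proj W (P v \<inter> {y<..})))"
      unfolding h_def
      by (intro sum_mono cond_entropy_antimono[OF S(1)]) (auto simp: proj_eq_iff P_def V_def)
    also have "\<dots> = cond_entropy S (proj W (P v)) (\<lambda>_. ())"
      by (rule cond_entropy_proj_chain[OF S(1) fins(1), symmetric])
    finally have "real (card (P v)) * h v + (\<Sum>y\<in>P v. h y) \<le>
        real (card (P v)) * cond_entropy S (\<lambda>s. W s v) (proj W {v<..m}) + cond_entropy S (proj W (P v)) (\<lambda>_. ())"
      by (simp add: h_def)
    also have "\<dots> \<le> N * (lq + real (card (P v)) * (2 * lc))"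
      unfolding N_def lq_def lc_def
    proof (rule cond_entropy_vertex_le[OF S(1) fins(1) False])
      show "P v \<subseteq> {v<..m}" by (auto simp: P_def V_def)
      show "W s x \<in> {1..q}" if "s \<in> S" "x \<in> insert v (P v)" for s x
        using W[OF that(1)] that(2) v by (auto simp: P_def V_def)
      show "q \<le> W s v + W s y" if "s \<in> S" "y \<in> P v" for s y
        using con[OF that(1)] that(2) v by (auto simp: P_def V_def)
    qed
    finally show ?thesis using False v by (simp add: R_def algebra_simps)
  qed

  \<comment> \<open>Each \<open>i \<in> I\<close> pairs \<open>v\<close> with a larger, equal or smaller position, or with one beyond \<open>m\<close>.\<close>
  have n_split: "n = real (card (d v)) + real (card (lp v)) + real (card (P v)) + real (card (s v))"
    if v: "v \<in> V" for v
  proof -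
    have "I = d v \<union> (\<lambda>y. v + y) ` (lp v \<union> P v \<union> s v)"
    proof (intro equalityI subsetI)
      fix i assume i: "i \<in> I"
      show "i \<in> d v \<union> (\<lambda>y. v + y) ` (lp v \<union> P v \<union> s v)"
      proof (cases "m + v < i")
        case True
        then show ?thesis using i by (simp add: d_def)
      next
        case False
        have "v < i" using i I v by (auto simp: V_def)
        then have "i = v + (i - v)" "i - v \<in> V" using False by (auto simp: V_def)
        moreover have "i - v \<in> lp v \<union> P v \<union> s v"
          using i \<open>i - v \<in> V\<close> \<open>v < i\<close> by (auto simp: lp_def P_def s_def)
        ultimately show ?thesis by blast
      qed
    qed (auto simp: d_def lp_def P_def s_def)
    moreover have "d v \<inter> (\<lambda>y. v + y) ` (lp v \<union> P v \<union> s v) = {}"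
      by (auto simp: d_def lp_def P_def s_def V_def)
    ultimately have "card I = card (d v) + card ((\<lambda>y. v + y) ` (lp v \<union> P v \<union> s v))"
      using card_Un_disjoint fins by (metis finite_UnI finite_imageI)
    also have "card ((\<lambda>y. v + y) ` (lp v \<union> P v \<union> s v)) = card (lp v \<union> P v \<union> s v)"
      by (intro card_image) (auto simp: inj_on_def)
    also have "card (lp v \<union> P v \<union> s v) = card (lp v \<union> P v) + card (s v)"
      by (intro card_Un_disjoint) (auto simp: fins, auto simp: lp_def P_def s_def)
    also have "card (lp v \<union> P v) = card (lp v) + card (P v)"
      by (intro card_Un_disjoint) (auto simp: fins, auto simp: lp_def P_def)
    finally show ?thesis by (simp add: n_def)
  qed
  \<comment> \<open>\<open>y\<close> is a smaller partner of \<open>v\<close> exactly when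
    \<open>v\<close> is a larger partner of \<open>y\<close>, so the share of \<open>v\<close> from
    smaller partners moves to their vertex inequalities.\<close>
  have swap: "(\<Sum>v\<in>V. real (card (s v)) * H v) = (\<Sum>v\<in>V. \<Sum>y\<in>P v. H y)" for H :: "nat \<Rightarrow> real"
  proof -
    have "(\<Sum>v\<in>V. real (card (s v)) * H v) = (\<Sum>v\<in>V. \<Sum>y\<in>s v. H v)" by simp
    also have "\<dots> = (\<Sum>v\<in>V. \<Sum>y\<in>V. if y < v \<and> v + y \<in> I then H v else 0)"
      unfolding s_def by (intro sum.cong refl sum.inter_filter finV)
    also have "\<dots> = (\<Sum>v\<in>V. \<Sum>y\<in>V. if v < y \<and> y + v \<in> I then H y else 0)"
      by (rule sum.swap)
    also have "\<dots> = (\<Sum>v\<in>V. \<Sum>y\<in>P v. H y)"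
      unfolding P_def sum.inter_filter[OF finV] by (simp only: add.commute)
    finally show ?thesis .
  qed
  define D where "D = (\<Sum>v\<in>V. real (card (d v)))"
  define L where "L = (\<Sum>v\<in>V. real (card (lp v)))"
  define PP where "PP = (\<Sum>v\<in>V. real (card (P v)))"
  have count: "n * real m = D + L + 2 * PP"
  proof -
    have "n * real m = (\<Sum>v\<in>V. n)" by (simp add: V_def)
    also have "\<dots> = (\<Sum>v\<in>V. real (card (d v)) + real (card (lp v)) + real (card (P v)) + real (card (s v)))"
      by (rule sum.cong[OF refl n_split])
    also have "\<dots> = D + L + PP + (\<Sum>v\<in>V. real (card (s v)))" by (simp add: sum.distrib D_def L_def PP_def)
    also have "(\<Sum>v\<in>V. real (card (s v))) = PP" using swap[of "\<lambda>_. 1"] by (simp add: PP_def)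
    finally show ?thesis by simp
  qed
  have D_le: "D \<le> n * real t"
  proof -
    have "D = (\<Sum>v\<in>V. \<Sum>i\<in>d v. 1)" by (simp add: D_def)
    also have "\<dots> = (\<Sum>v\<in>V. \<Sum>i\<in>I. if m + v < i then 1 else 0)"
      unfolding d_def by (intro sum.cong refl sum.inter_filter finI)
    also have "\<dots> = (\<Sum>i\<in>I. \<Sum>v\<in>V. if m + v < i then 1 else 0)" by (rule sum.swap)
    also have "\<dots> = (\<Sum>i\<in>I. real (card {v\<in>V. m + v < i}))"
      by (intro sum.cong refl) (simp add: sum.inter_filter[OF finV, symmetric])
    also have "\<dots> \<le> (\<Sum>i\<in>I. real t)"
    proof (rule sum_mono)
      fix i assume "i \<in> I"
      \<comment> \<open>As \<open>i \<le> m + t\<close>, a partner beyond \<open>m\<close> requires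
        \<open>v < t\<close>.\<close>
      then have "{v\<in>V. m + v < i} \<subseteq> {1..t}" using I by (force simp: V_def)
      from card_mono[OF _ this] show "real (card {v\<in>V. m + v < i}) \<le> real t" by simp
    qed
    finally show ?thesis by (simp add: n_def)
  qed
  have R_le: "real (card R) \<le> (real m + real t) / 2"
  proof -
    \<comment> \<open>A larger partner \<open>y\<close> with \<open>v + y \<le> m + t\<close> forces
      \<open>2 * v < m + t\<close>.\<close>
    have "R \<subseteq> {1..(m + t) div 2}" using I by (force simp: R_def P_def V_def)
    from card_mono[OF _ this] show ?thesis by simp
  qed

  have "n * (N * ln N) = (\<Sum>v\<in>V. n * h v)" unfolding total by (rule sum_distrib_left)
  also have "\<dots> = (\<Sum>v\<in>V. real (card (d v)) * h v + real (card (lp v)) * h v + real (card (P v)) * h v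
      + real (card (s v)) * h v)"
    by (intro sum.cong refl) (simp only: n_split distrib_right)
  also have "\<dots> = (\<Sum>v\<in>V. real (card (d v)) * h v) + (\<Sum>v\<in>V. real (card (lp v)) * h v)
      + (\<Sum>v\<in>V. real (card (P v)) * h v + (\<Sum>y\<in>P v. h y))"
    unfolding sum.distrib swap by simp
  also have "\<dots> \<le> (\<Sum>v\<in>V. real (card (d v)) * (N * lq)) + (\<Sum>v\<in>V. real (card (lp v)) * (N * lc))
      + (\<Sum>v\<in>V. N * (real (card (P v)) * (2 * lc)) + (if v \<in> R then N * lq else 0))"
  proof (rule add_mono[OF add_mono]; rule sum_mono)
    fix v assume v: "v \<in> V"
    show "real (card (d v)) * h v \<le> real (card (d v)) * (N * lq)"
      using h_lq[OF v] by (intro mult_left_mono) auto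
    show "real (card (lp v)) * h v \<le> real (card (lp v)) * (N * lc)"
    proof (cases "v + v \<in> I")
      case True
      then show ?thesis using h_lc[OF v] by (intro mult_left_mono) auto
    next
      case False
      then have "lp v = {}" by (auto simp: lp_def)
      then show ?thesis by simp
    qed
    show "real (card (P v)) * h v + (\<Sum>y\<in>P v. h y)
        \<le> N * (real (card (P v)) * (2 * lc)) + (if v \<in> R then N * lq else 0)"
      by (rule h_P[OF v])
  qed
  also have "\<dots> = N * (D * lq + L * lc + PP * (2 * lc) + real (card R) * lq)"
  proof -
    have "(\<Sum>v\<in>V. if v \<in> R then N * lq else 0) = real (card R) * (N * lq)"
      using sum.inter_filter[OF finV, of "\<lambda>_. N * lq" "\<lambda>v. v \<in> R"]
      by (simp add: R_def)
    then show ?thesis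
      unfolding sum.distrib sum_distrib_left[symmetric] sum_distrib_right[symmetric]
        D_def[symmetric] L_def[symmetric] PP_def[symmetric]
      by (simp add: algebra_simps)
  qed
  finally have "N * (n * ln N) \<le> N * (D * lq + L * lc + PP * (2 * lc) + real (card R) * lq)"
    by (simp add: algebra_simps)
  then have "n * ln N \<le> D * lq + L * lc + PP * (2 * lc) + real (card R) * lq"
    using N0 by simp
  \<comment> \<open>Regrouped so that \<open>count\<close> evaluates the factor of \<open>lc\<close>
    exactly, and \<open>D\<close>, known only from above, has the nonnegative factor
    \<open>lq - lc\<close>.\<close>
  also have "\<dots> = D * (lq - lc) + (D + L + 2 * PP) * lc + real (card R) * lq"
    by (simp add: algebra_simps)
  also have "\<dots> \<le> (n * real t) * (lq - lc) + (n * real m) * lc + (real m + real t) / 2 * lq"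
    unfolding count[symmetric] using D_le R_le lclq lq0 lc0 by (intro add_mono mult_right_mono) auto
  also have "\<dots> = n * (real t * lq + (real m - real t) * lc) + (real m + real t) / 2 * lq"
    by (simp add: algebra_simps)
  finally show ?thesis by (simp add: n_def N_def lq_def lc_def)
qed

section \<open>From the entropy bound to counting tail-heavy words\<close>

lemma finite_words: "finite (words q l)"
  and card_words: "card (words q l) = q ^ l"
proof -
  have "words q l = {w. set w \<subseteq> {1..q} \<and> length w = l}" by (auto simp: words_def)
  then show "finite (words q l)" "card (words q l) = q ^ l"
    by (simp_all add: finite_lists_length_eq card_lists_length_eq)
qed

text \<open>The prefixes of length \<open>m = l - t\<close> that are admissible for a fixed set
  \<open>I\<close> of heavy positions.\<close>

definition sum_constrained :: "nat \<Rightarrow> nat \<Rightarrow> nat set \<Rightarrow> nat list set" where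
  "sum_constrained q m I = {u \<in> words q m. \<forall>x\<in>{1..m}. \<forall>y\<in>{1..m}.
     x + y \<in> I \<longrightarrow> q \<le> u ! (x - 1) + u ! (y - 1)}"

lemma card_sum_constrained_le:
  assumes q: "q \<ge> 2" and I: "I \<subseteq> {m<..m+t}" and n: "sqrt (real (m + t)) < real (card I)"
  shows "real (card (sum_constrained q m I))
    \<le> real q ^ t * c_const q powr (real m - real t + sqrt (real (m + t)))"
proof (cases "sum_constrained q m I = {}")
  case True
  then show ?thesis by simp
next
  case False
  let ?S = "sum_constrained q m I"
  let ?n = "real (card I)" and ?r = "sqrt (real (m + t))"
  have fin: "finite ?S" using finite_words by (auto simp: sum_constrained_def)
  have c0: "c_const q > 0" using c_const_ge_1[of q] by simp
  have N0: "card ?S > 0" using fin False by (simp add: card_gt_0_iff)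
  have n0: "?n > 0" using n real_sqrt_ge_zero[of "real (m + t)"] by linarith
  have "?n * ln (real (card ?S)) \<le>
    ?n * (real t * ln (real q) + (real m - real t) * ln (c_const q))
      + (real m + real t) / 2 * ln (real q)"
  proof (rule ln_card_sum_constrained_le[OF fin False _ _ I _ q, where W="\<lambda>u x. u ! (x - 1)"])
    fix u u' assume u: "u \<in> ?S" "u' \<in> ?S" and eq: "\<forall>x\<in>{1..m}. u ! (x - 1) = u' ! (x - 1)"
    have len: "length u = m" "length u' = m" using u by (auto simp: sum_constrained_def words_def)
    show "u = u'"
    proof (rule nth_equalityI)
      fix i assume "i < length u"
      then show "u ! i = u' ! i" using eq[rule_format, of "Suc i"] len by simp
    qed (simp add: len)
  next
    fix u x assume u: "u \<in> ?S" "x \<in> {1..m}"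
    then have "u ! (x - 1) \<in> set u" by (intro nth_mem) (auto simp: sum_constrained_def words_def)
    then show "u ! (x - 1) \<in> {1..q}" using u by (auto simp: sum_constrained_def words_def)
  qed (auto simp: sum_constrained_def)
  \<comment> \<open>The size of \<open>I\<close> enters here: with \<open>l = m + t\<close>,
    \<open>ln q \<le> 2 * ln c\<close> bounds the left side by \<open>l * ln c\<close>, and
    \<open>l\<close> is the square of \<open>sqrt l < n\<close>. Division by \<open>n\<close> then
    leaves the exponent \<open>sqrt l\<close>.\<close>
  also have "(real m + real t) / 2 * ln (real q) \<le> ?n * (?r * ln (c_const q))"
  proof -
    have "ln (real q) \<le> ln (c_const q ^ 2)"
      using c_const_sq_ge[of q] q by (intro ln_mono) auto
    then have "ln (real q) \<le> 2 * ln (c_const q)" using c0 by (simp add: ln_realpow)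
    then have "(real m + real t) / 2 * ln (real q) \<le> (real m + real t) / 2 * (2 * ln (c_const q))"
      by (intro mult_left_mono) auto
    also have "\<dots> = ?r * ?r * ln (c_const q)" by simp
    also have "\<dots> \<le> ?n * ?r * ln (c_const q)"
      using n c_const_ge_1[of q] by (intro mult_right_mono) auto
    finally show ?thesis by simp
  qed
  finally have "?n * ln (real (card ?S)) \<le>
      ?n * (real t * ln (real q) + (real m - real t + ?r) * ln (c_const q))"
    by (simp add: algebra_simps)
  then have "ln (real (card ?S)) \<le> real t * ln (real q) + (real m - real t + ?r) * ln (c_const q)"
    using n0 by simp
  also have "\<dots> = ln (real q ^ t * c_const q powr (real m - real t + ?r))"
    using q c0 by (simp add: ln_mult ln_realpow ln_powr)
  finally show ?thesis using N0 q c0 by (subst (asm) ln_le_cancel_iff) auto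
qed

text \<open>Such a word is recovered from its prefix and its tail letters outside \<open>I\<close>,
  the letters on \<open>I\<close> all being \<open>q\<close>.\<close>

lemma card_words_with_heavy_set_le:
  assumes I: "I \<subseteq> {m<..m+t}"
  shows "card {w \<in> words q (m + t). take m w \<in> sum_constrained q m I \<and> (\<forall>i\<in>I. w ! (i - 1) = q)}
    \<le> card (sum_constrained q m I) * q ^ (t - card I)"
    (is "card ?T \<le> _")
proof -
  let ?J = "{m<..m+t} - I"
  let ?f = "\<lambda>w. (take m w, restrict (\<lambda>i. w ! (i - 1)) ?J)"
  have fin: "finite (sum_constrained q m I)" using finite_words by (auto simp: sum_constrained_def)
  have "inj_on ?f ?T"
  proof (rule inj_onI)
    fix w w' assume w: "w \<in> ?T" "w' \<in> ?T" and eq: "?f w = ?f w'"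
    have len: "length w = m + t" "length w' = m + t" using w by (auto simp: words_def)
    show "w = w'"
    proof (rule nth_equalityI)
      fix i assume i: "i < length w"
      \<comment> \<open>List index \<open>i\<close> is position \<open>Suc i\<close> of the
        word.\<close>
      consider "i < m" | "Suc i \<in> I" | "Suc i \<in> ?J" using i len by fastforce
      then show "w ! i = w' ! i"
      proof cases
        case 1
        then show ?thesis using eq by (metis nth_take prod.inject)
      next
        case 2
        then have "w ! (Suc i - 1) = q" "w' ! (Suc i - 1) = q" using w by blast+
        then show ?thesis by simp
      next
        case 3
        have "restrict (\<lambda>i. w ! (i - 1)) ?J (Suc i) = restrict (\<lambda>i. w' ! (i - 1)) ?J (Suc i)"
          using eq by simp
        then show ?thesis using 3 by simp
      qed
    qed (simp add: len)
  qed
  moreover have "?f ` ?T \<subseteq> sum_constrained q m I \<times> PiE ?J (\<lambda>_. {1..q})"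
  proof -
    have "w ! (i - 1) \<in> {1..q}" if "w \<in> words q (m + t)" "i \<in> ?J" for w i
    proof -
      have "w ! (i - 1) \<in> set w" using that by (intro nth_mem) (auto simp: words_def)
      then show ?thesis using that by (auto simp: words_def)
    qed
    then show ?thesis by (auto simp: restrict_def PiE_def extensional_def)
  qed
  moreover have "finite (sum_constrained q m I \<times> PiE ?J (\<lambda>_. {1..q}))"
    using fin by (intro finite_cartesian_product finite_PiE) auto
  ultimately have "card ?T \<le> card (sum_constrained q m I \<times> PiE ?J (\<lambda>_. {1..q}))"
    by (rule card_inj_on_le)
  also have "card (PiE ?J (\<lambda>_. {1..q})) = q ^ (t - card I)"
    using I by (simp add: card_PiE card_Diff_subset finite_subset)
  then have "card (sum_constrained q m I \<times> PiE ?J (\<lambda>_. {1..q}))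
      = card (sum_constrained q m I) * q ^ (t - card I)"
    by (simp add: card_cartesian_product)
  finally show ?thesis .
qed

text \<open>A union bound over the possible sets \<open>I\<close>. The prefix bound does not depend
  on \<open>I\<close>, so only the numbers of tails have to be summed.\<close>

lemma card_tail_heavy_le:
  assumes q: "q \<ge> 2"
  shows "real (card {w \<in> words q (m + t). tail_heavy t q w})
    \<le> real q ^ t * c_const q powr (real (m + t) + sqrt (real (m + t)))"
proof -
  let ?r = "sqrt (real (m + t))"
  define T where "T I = {w \<in> words q (m + t). take m w \<in> sum_constrained q m I \<and> (\<forall>i\<in>I. w ! (i - 1) = q)}" for I
  define F where "F = {I \<in> Pow {m<..m+t}. ?r < real (card I)}"
  define B where "B = real q ^ t * c_const q powr (real m - real t + ?r)"
  have c0: "c_const q > 0" using c_const_ge_1[of q] by simp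
  have B0: "B \<ge> 0" by (simp add: B_def)
  have finF: "finite F" by (simp add: F_def)
  have finT: "finite (T I)" for I using finite_words by (auto simp: T_def)
  have "{w \<in> words q (m + t). tail_heavy t q w} \<subseteq> (\<Union>I\<in>F. T I)"
  proof
    fix w assume "w \<in> {w \<in> words q (m + t). tail_heavy t q w}"
    then have w: "w \<in> words q (m + t)" "length w = m + t" "tail_heavy t q w"
      by (auto simp: words_def)
    then obtain I where I: "I \<subseteq> {m<..m+t}" "?r < real (card I)" "\<forall>i\<in>I. w ! (i - 1) = q"
      and con: "\<forall>x y. 1 \<le> x \<and> x \<le> m \<and> 1 \<le> y \<and> y \<le> m \<and> x + y \<in> I \<longrightarrow> w ! (x - 1) + w ! (y - 1) \<ge> q"
      by (auto simp: tail_heavy_def Let_def)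
    have "set (take m w) \<subseteq> {1..q}" using w(1) set_take_subset[of m w] by (auto simp: words_def)
    then have "take m w \<in> sum_constrained q m I"
      using w(2) con by (auto simp: sum_constrained_def words_def)
    then show "w \<in> (\<Union>I\<in>F. T I)" using I w(1) by (auto simp: T_def F_def)
  qed
  then have "card {w \<in> words q (m + t). tail_heavy t q w} \<le> card (\<Union>I\<in>F. T I)"
    using finF finT by (intro card_mono) auto
  also have "\<dots> \<le> (\<Sum>I\<in>F. card (T I))" by (rule card_UN_le[OF finF])
  finally have "real (card {w \<in> words q (m + t). tail_heavy t q w}) \<le> (\<Sum>I\<in>F. real (card (T I)))"
    by (metis of_nat_le_iff of_nat_sum)
  also have "\<dots> \<le> (\<Sum>I\<in>F. B * real q ^ (t - card I))"
  proof (rule sum_mono)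
    fix I assume I: "I \<in> F"
    have "real (card (T I)) \<le> real (card (sum_constrained q m I) * q ^ (t - card I))"
      unfolding T_def of_nat_le_iff
      by (rule card_words_with_heavy_set_le) (use I in \<open>auto simp: F_def\<close>)
    also have "\<dots> \<le> B * real q ^ (t - card I)"
      using card_sum_constrained_le[OF q, of I m t] I
      by (simp add: F_def B_def mult_right_mono)
    finally show "real (card (T I)) \<le> B * real q ^ (t - card I)" .
  qed
  also have "\<dots> \<le> (\<Sum>I\<in>Pow {m<..m+t}. B * real q ^ (t - card I))"
    using B0 by (intro sum_mono2) (auto simp: F_def)
  also have "\<dots> = B * (\<Sum>I\<in>Pow {m<..m+t}. real q ^ (t - card I))" by (simp add: sum_distrib_left)
  also have "(\<Sum>I\<in>Pow {m<..m+t}. real q ^ (t - card I)) = (1 + real q) ^ t"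
  proof -
    \<comment> \<open>Expanding one factor \<open>1 + q\<close> per tail position, the set
      \<open>I\<close> records where the summand 1 is chosen.\<close>
    have "(1 + real q) ^ t = (\<Prod>i\<in>{m<..m+t}. 1 + real q)" by simp
    also have "\<dots> = (\<Sum>I\<in>Pow {m<..m+t}. (\<Prod>i\<in>I. 1) * (\<Prod>i\<in>{m<..m+t} - I. real q))"
      by (rule prod_add) simp
    also have "\<dots> = (\<Sum>I\<in>Pow {m<..m+t}. real q ^ (t - card I))"
      by (intro sum.cong refl) (auto simp: card_Diff_subset finite_subset)
    finally show ?thesis by simp
  qed
  \<comment> \<open>The factor \<open>c^(2 * t)\<close> turns the exponent \<open>m - t\<close> of
    the prefix bound into \<open>m + t = l\<close>.\<close>
  also have "B * (1 + real q) ^ t \<le> B * (c_const q ^ 2) ^ t"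
    using c_const_sq_ge[of q] B0 by (intro mult_left_mono power_mono) auto
  also have "\<dots> = real q ^ t * (c_const q powr (real m - real t + ?r) * c_const q powr (2 * real t))"
    using powr_realpow[OF c0, of "2 * t"] by (simp add: B_def power_mult)
  also have "\<dots> = real q ^ t * c_const q powr (real (m + t) + ?r)"
    by (simp add: powr_add[symmetric] algebra_simps)
  finally show ?thesis .
qed

theorem theorem3p7:
  fixes q l t :: nat
  assumes "q \<ge> 1" "l \<ge> 1" "t \<ge> 1"
  shows "real (card {w \<in> words q l. tail_heavy t q w})
           \<le> real t * real q ^ t * c_const q powr (real l + sqrt (real l) + 10)"
proof -
  let ?H = "{w \<in> words q l. tail_heavy t q w}"
  let ?e = "real l + sqrt (real l)"
  have "real (card ?H) \<le> real q ^ t * c_const q powr ?e"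
  proof (cases "q \<ge> 2 \<and> t \<le> l")
    case True
    then obtain m where "l = m + t" by (metis add.commute le_Suc_ex)
    then show ?thesis using card_tail_heavy_le[of q m t] True by simp
  next
    case False
    \<comment> \<open>Either \<open>q = 1\<close> and both powers are 1, or \<open>l < t\<close>; in
      both cases the number \<open>q ^ l\<close> of all words is small enough.\<close>
    then have "q ^ l \<le> q ^ t" using assms
      by (cases "q = 1") (auto intro!: power_increasing)
    moreover have "card ?H \<le> q ^ l"
      using card_mono[OF finite_words, of ?H q l] by (simp add: card_words)
    ultimately have "real (card ?H) \<le> real q ^ t * 1"
      by (metis le_trans mult.right_neutral of_nat_le_iff of_nat_power)
    also have "\<dots> \<le> real q ^ t * c_const q powr ?e"
      using c_const_ge_1[of q] by (intro mult_left_mono ge_one_powr_ge_zero) auto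
    finally show ?thesis .
  qed
  also have "\<dots> \<le> (real t * real q ^ t) * c_const q powr (?e + 10)"
    using assms c_const_ge_1[of q] by (intro mult_mono powr_mono) (auto simp: mult_le_cancel_right1)
  finally show ?thesis .
qed

end
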